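(* Let $P_C=\{x\in\mathbb{R}^n_+ : Ax\ge b\}$ with $(A,b)\in\mathbb{Q}_+^{m\times n}\times\mathbb{Q}_+^m$ be a well-behaved covering polyhedron, i.e. $A_{ij}\le b_i$ for all $i\in\{1,\dots,m\}$, $j\in\{1,\dots,n\}$. Then $$\operatorname{rank}_{\mathcal{S}}(P_C)\ \ge\ \sup_{c\in\mathbb{R}^n_+}\left\lceil\log_2\left(\frac{z^I(c)}{z^{LP}(c)}\right)\right\rceil,$$ where the supremum ranges over those $c\in\mathbb{R}^n_+$ for which the quotient is defined.
   Context: For $c\in\mathbb{R}^n_+$, $z^{LP}(c)=\min\{c^\top x: x\in P_C\}$ and $z^I(c)=\min\{c^\top x: x\in P_C^I\}$, where $P_C^I=\operatorname{conv}(P_C\cap\mathbb{Z}^n)$ is the integer hull. For $(\pi,\pi_0)\in\mathbb{Z}^n\times\mathbb{Z}$ let $S(\pi,\pi_0)=\{x\in\mathbb{R}^n:\pi_0<\pi^\top x<\pi_0+1\}$. The split closure of a set $P\subseteq\mathbb{R}^n$ is $\mathcal{S}(P)=\bigcap_{(\pi,\pi_0)\in\mathbb{Z}^n\times\mathbb{Z}}\operatorname{conv}(P\setminus S(\pi,\pi_0))$. The split rank $\operatorname{rank}_{\mathcal{S}}(P)$ is the minimum number of iterated applications of $\mathcal{S}$, starting from $P$, needed to obtain the integer hull of $P$. *)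

theory Defs
  imports "HOL-Analysis.Analysis" "HOL-Library.Extended_Nat" "HOL-Library.Extended_Real"
begin

definition covering_polyhedron :: "real^'n^'m \<Rightarrow> real^'m \<Rightarrow> (real^'n) set" where
  "covering_polyhedron A b = {x. (\<forall>j. 0 \<le> x $ j) \<and> (\<forall>i. (A *v x) $ i \<ge> b $ i)}"

definition well_behaved :: "real^'n^'m \<Rightarrow> real^'m \<Rightarrow> bool" where
  "well_behaved A b \<longleftrightarrow> (\<forall>i j. A $ i $ j \<le> b $ i)"

definition int_vectors :: "(real^'n) set" where
  "int_vectors = {x. \<forall>j. x $ j \<in> \<int>}"

definition integer_hull :: "(real^'n) set \<Rightarrow> (real^'n) set" where
  "integer_hull P = convex hull (P \<inter> int_vectors)"

definition split_set :: "real^'n \<Rightarrow> int \<Rightarrow> (real^'n) set" where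
  "split_set \<pi> \<pi>0 = {x. of_int \<pi>0 < \<pi> \<bullet> x \<and> \<pi> \<bullet> x < of_int \<pi>0 + 1}"

definition split_closure :: "(real^'n) set \<Rightarrow> (real^'n) set" where
  "split_closure P = (\<Inter>\<pi>\<in>int_vectors. \<Inter>\<pi>0::int. convex hull (P - split_set \<pi> \<pi>0))"

text \<open>The infimum is the least such \<open>k\<close>, or \<open>\<infinity>\<close> if the integer hull is never reached.\<close>
definition split_rank :: "(real^'n) set \<Rightarrow> enat" where
  "split_rank P = (INF k\<in>{k. (split_closure ^^ k) P = integer_hull P}. enat k)"

text \<open>The minimum of a linear objective; unspecified if no minimum is attained.\<close>
definition min_value :: "(real^'n) set \<Rightarrow> real^'n \<Rightarrow> real" where
  "min_value P c = (LEAST v. v \<in> (\<lambda>x. c \<bullet> x) ` P)"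

definition z_LP :: "real^'n^'m \<Rightarrow> real^'m \<Rightarrow> real^'n \<Rightarrow> real" where
  "z_LP A b c = min_value (covering_polyhedron A b) c"

definition z_I :: "real^'n^'m \<Rightarrow> real^'m \<Rightarrow> real^'n \<Rightarrow> real" where
  "z_I A b c = min_value (integer_hull (covering_polyhedron A b)) c"

text \<open>Nonnegative objectives for which the quotient of the two minima is defined. For nonnegative
  rational \<open>A\<close> and \<open>b\<close>, both minima are attained as soon as the polyhedron is nonempty, so only
  emptiness and a zero denominator have to be excluded.\<close>
definition admissible_objectives :: "real^'n^'m \<Rightarrow> real^'m \<Rightarrow> (real^'n) set" where
  "admissible_objectives A b =
     {c. (\<forall>j. 0 \<le> c $ j) \<and> covering_polyhedron A b \<noteq> {} \<and> z_LP A b c \<noteq> 0}"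

end

theory Submission imports Defs begin

text \<open>Let \<open>D\<^sub>r(Q)\<close> consist of the nonnegative \<open>y\<close> such that every nonnegative point whose total
  decrease relative to \<open>y\<close> is at most \<open>r\<close> still lies in \<open>Q\<close>. If \<open>y \<in> D\<^sub>1(Q)\<close> lies strictly inside
  a split, then lowering coordinates with \<open>\<pi>\<^sub>j \<ge> 1\<close> (or \<open>\<pi>\<^sub>j \<le> -1\<close>, depending on the sign of
  \<open>\<pi>\<^sub>0\<close>) by a total of at most \<open>1\<close> already leaves the split, and so does moving far enough in the
  opposite direction; hence \<open>D\<^sub>1(Q)\<close> is contained in the split closure of \<open>Q\<close>, and inductively
  \<open>D\<^sub>k(Q)\<close> in the \<open>k\<close>-th one. Well-behavedness gives \<open>(1 + k) x \<in> D\<^sub>k(P)\<close> for \<open>x \<in> P\<close>.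
  So rank \<open>k\<close> forces \<open>z\<^sup>I \<le> (1 + k) z\<^sup>L\<^sup>P \<le> 2\<^sup>k z\<^sup>L\<^sup>P\<close>.\<close>

section \<open>Decrease cores and how they pass through split closures\<close>

definition decrease :: "real^'n \<Rightarrow> real^'n \<Rightarrow> real" where
  "decrease y y' = (\<Sum>j\<in>UNIV. max (y $ j - y' $ j) 0)"

definition decrease_core :: "real \<Rightarrow> (real^'n) set \<Rightarrow> (real^'n) set" where
  "decrease_core r Q =
    {y. (\<forall>j. 0 \<le> y $ j) \<and> (\<forall>y'. (\<forall>j. 0 \<le> y' $ j) \<longrightarrow> decrease y y' \<le> r \<longrightarrow> y' \<in> Q)}"

text \<open>Only downward moves count, so \<open>decrease\<close> is a directed l1 distance; upward
  moves are free.\<close>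

lemma decrease_triangle: "decrease x z \<le> decrease x y + decrease y z"
  unfolding decrease_def sum.distrib [symmetric] by (rule sum_mono) auto

text \<open>Take \<open>y\<close> restricted to \<open>J\<close>, scaled down to total 1 if it
  exceeds that. Either the budget 1 is spent or the coordinates in \<open>J\<close> are
  emptied.\<close>

lemma truncated_decrease_exists:
  fixes y :: "real^'n"
  assumes y: "\<And>j. 0 \<le> y $ j"
  obtains s :: "real^'n" where "\<And>j. 0 \<le> s $ j" "\<And>j. s $ j \<le> y $ j"
    "\<And>j. j \<notin> J \<Longrightarrow> s $ j = 0" "(\<Sum>j\<in>UNIV. s $ j) \<le> 1"
    "(\<Sum>j\<in>UNIV. s $ j) = 1 \<or> (\<forall>j\<in>J. s $ j = y $ j)"
proof -
  define t where "t = sum (($) y) J"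
  have t0: "0 \<le> t" unfolding t_def by (simp add: sum_nonneg y)
  define l where "l = (if t \<le> 1 then 1 else 1 / t)"
  define s :: "real^'n" where "s = (\<chi> j. if j \<in> J then l * y $ j else 0)"
  have l: "0 \<le> l" "l \<le> 1" by (auto simp: l_def)
  have "(\<Sum>j\<in>UNIV. s $ j) = l * t"
    by (simp add: s_def t_def sum_distrib_left sum.If_cases)
  moreover have "l * t \<le> 1" "l * t = 1 \<or> l = 1" by (auto simp: l_def)
  ultimately show thesis
    using l y by (intro that[of s]) (auto simp: s_def mult_left_le_one_le)
qed

text \<open>The budget is spent where \<open>\<pi>\<close> is positive. Positive integer entries are
  at least 1, so a full budget lowers \<open>\<pi> \<bullet> y\<close> by at least 1; otherwise no
  positive contribution remains and the value is at most 0, hence at most \<open>k\<close>.\<close>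

lemma int_vector_escape:
  fixes y \<pi> :: "real^'n"
  assumes y: "\<And>j. 0 \<le> y $ j" and \<pi>: "\<pi> \<in> int_vectors"
    and lo: "of_int k < \<pi> \<bullet> y" and hi: "\<pi> \<bullet> y < of_int k + 1" and k: "0 \<le> k"
  obtains s :: "real^'n" where "\<And>j. 0 \<le> s $ j" "\<And>j. s $ j \<le> y $ j"
    "(\<Sum>j\<in>UNIV. s $ j) \<le> 1" "\<pi> \<bullet> (y - s) \<le> of_int k"
proof -
  obtain s :: "real^'n" where s: "\<And>j. 0 \<le> s $ j" "\<And>j. s $ j \<le> y $ j"
    "\<And>j. j \<notin> {j. 0 < \<pi> $ j} \<Longrightarrow> s $ j = 0" "(\<Sum>j\<in>UNIV. s $ j) \<le> 1"
    "(\<Sum>j\<in>UNIV. s $ j) = 1 \<or> (\<forall>j\<in>{j. 0 < \<pi> $ j}. s $ j = y $ j)"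
    by (rule truncated_decrease_exists[OF y, of "{j. 0 < \<pi> $ j}"]) (rule that, simp_all)
  have "\<pi> \<bullet> (y - s) \<le> of_int k"
    using s(5)
  proof
    assume 1: "(\<Sum>j\<in>UNIV. s $ j) = 1"
    have "s $ j \<le> \<pi> $ j * s $ j" for j
    proof (cases "0 < \<pi> $ j")
      case True
      have "\<pi> $ j \<in> \<int>" using \<pi> by (simp add: int_vectors_def)
      with True have "1 \<le> \<pi> $ j" by (auto elim!: Ints_cases)
      then show ?thesis using s(1)[of j] mult_right_mono by fastforce
    qed (use s(3) in auto)
    then have "(\<Sum>j\<in>UNIV. s $ j) \<le> \<pi> \<bullet> s"
      by (simp add: inner_vec_def sum_mono)
    then show ?thesis using 1 hi by (simp add: inner_diff_right)
  next
    assume all: "\<forall>j\<in>{j. 0 < \<pi> $ j}. s $ j = y $ j"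
    have "\<pi> $ j * (y $ j - s $ j) \<le> 0" for j
      using all s(2)[of j] by (cases "0 < \<pi> $ j") (auto simp: mult_le_0_iff)
    then have "\<pi> \<bullet> (y - s) \<le> 0" by (simp add: inner_vec_def sum_nonpos)
    then show ?thesis using k by linarith
  qed
  then show thesis by (rule that[OF s(1,2,4)])
qed

lemma decrease_core_1_hull:
  fixes Q :: "(real^'n) set"
  assumes y: "y \<in> decrease_core 1 Q" and \<pi>: "\<pi> \<in> int_vectors" and k: "0 \<le> k"
  shows "y \<in> convex hull (Q - split_set \<pi> k)"
proof (cases "y \<in> split_set \<pi> k")
  case False
  moreover have "y \<in> Q" using y by (auto simp: decrease_core_def decrease_def)
  ultimately show ?thesis by (simp add: hull_inc)
next
  case True
  have y0: "\<And>j. 0 \<le> y $ j"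
    and yQ: "\<And>y'. (\<And>j. 0 \<le> y' $ j) \<Longrightarrow> decrease y y' \<le> 1 \<Longrightarrow> y' \<in> Q"
    using y by (auto simp: decrease_core_def)
  from True have lo: "of_int k < \<pi> \<bullet> y" and hi: "\<pi> \<bullet> y < of_int k + 1"
    by (auto simp: split_set_def)
  obtain s :: "real^'n" where s: "\<And>j. 0 \<le> s $ j" "\<And>j. s $ j \<le> y $ j"
    "(\<Sum>j\<in>UNIV. s $ j) \<le> 1" "\<pi> \<bullet> (y - s) \<le> of_int k"
    by (rule int_vector_escape[OF y0 \<pi> lo hi k]) (rule that, simp_all)
  have ps: "0 < \<pi> \<bullet> s" using s(4) lo by (simp add: inner_diff_right)
  \<comment> \<open>This step length raises \<open>\<pi> \<bullet> y\<close> by exactly 1, past the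
    upper side of the split.\<close>
  define t where "t = 1 / (\<pi> \<bullet> s)"
  have t: "0 < t" "\<pi> \<bullet> (t *\<^sub>R s) = 1" using ps by (auto simp: t_def)
  have a: "y - s \<in> Q - split_set \<pi> k"
    using s by (auto intro!: yQ simp: decrease_def split_set_def)
  have "decrease y (y + t *\<^sub>R s) \<le> 1"
    using s(1) t by (simp add: decrease_def max_absorb2)
  then have b: "y + t *\<^sub>R s \<in> Q - split_set \<pi> k"
    using s y0 t lo by (auto intro!: yQ add_nonneg_nonneg simp: split_set_def inner_add_right)
  \<comment> \<open>The weights make the displacements \<open>- s\<close> and
    \<open>t *\<^sub>R s\<close> cancel.\<close>
  have "y = (t / (1 + t)) *\<^sub>R (y - s) + (1 / (1 + t)) *\<^sub>R (y + t *\<^sub>R s)"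
  proof -
    have "(t / (1 + t)) *\<^sub>R (y - s) + (1 / (1 + t)) *\<^sub>R (y + t *\<^sub>R s)
        = (t / (1 + t) + 1 / (1 + t)) *\<^sub>R y"
      by (simp add: algebra_simps)
    also have "t / (1 + t) + 1 / (1 + t) = 1" using t by (simp add: field_simps)
    finally show ?thesis by simp
  qed
  moreover have "t / (1 + t) + 1 / (1 + t) = 1" using t by (simp add: field_simps)
  ultimately show ?thesis
    using convexD[OF convex_convex_hull hull_inc[OF a] hull_inc[OF b], of "t/(1+t)" "1/(1+t)"] t
    by simp
qed

text \<open>For \<open>k < 0\<close> the reflected level \<open>- k - 1\<close> is nonnegative, so
  nonnegative levels suffice.\<close>

lemma split_set_uminus: "split_set \<pi> k = split_set (- \<pi>) (- k - 1)"
  by (auto simp: split_set_def)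

lemma decrease_core_1_split_closure:
  fixes Q :: "(real^'n) set"
  shows "decrease_core 1 Q \<subseteq> split_closure Q"
proof -
  have "y \<in> convex hull (Q - split_set \<pi> k)"
    if y: "y \<in> decrease_core 1 Q" and \<pi>: "\<pi> \<in> int_vectors" for y \<pi> :: "real^'n" and k
  proof (cases "0 \<le> k")
    case True
    then show ?thesis using decrease_core_1_hull y \<pi> by blast
  next
    case False
    have "- \<pi> \<in> int_vectors" using \<pi> by (simp add: int_vectors_def)
    then show ?thesis
      using decrease_core_1_hull[OF y, of "- \<pi>" "- k - 1"] False split_set_uminus[of \<pi> k] by simp
  qed
  then show ?thesis by (auto simp: split_closure_def)
qed

text \<open>The budget splits by the triangle inequality: after a decrease of at most
  \<open>r\<close>, one unit is left, which places the point in
  \<open>decrease_core 1 Q\<close>.\<close>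

lemma decrease_core_split_closure:
  fixes Q :: "(real^'n) set"
  assumes "0 \<le> r"
  shows "decrease_core (r + 1) Q \<subseteq> decrease_core r (split_closure Q)"
proof
  fix y assume y: "y \<in> decrease_core (r + 1) Q"
  have "y' \<in> split_closure Q" if y': "\<forall>j. 0 \<le> y' $ j" "decrease y y' \<le> r" for y'
  proof -
    have "y' \<in> decrease_core 1 Q"
      unfolding decrease_core_def
    proof (intro CollectI conjI allI impI)
      fix z :: "real^'n" assume "\<forall>j. 0 \<le> z $ j" "decrease y' z \<le> 1"
      then show "z \<in> Q"
        using y y' decrease_triangle[of y z y'] by (auto simp: decrease_core_def)
    qed (use y' in auto)
    then show ?thesis using decrease_core_1_split_closure by blast
  qed
  then show "y \<in> decrease_core r (split_closure Q)"
    using y by (auto simp: decrease_core_def)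
qed

lemma decrease_core_funpow:
  "decrease_core (real k) Q \<subseteq> (split_closure ^^ k) Q"
\<comment> \<open>\<open>Q\<close> varies because each round trades one unit of budget for replacing
  \<open>Q\<close> by \<open>split_closure Q\<close>.\<close>
proof (induction k arbitrary: Q)
  case 0
  show ?case by (auto simp: decrease_core_def decrease_def)
next
  case (Suc k)
  have "decrease_core (real (Suc k)) Q \<subseteq> decrease_core (real k) (split_closure Q)"
    using decrease_core_split_closure[of "real k" Q] by (simp add: add.commute)
  also have "\<dots> \<subseteq> (split_closure ^^ k) (split_closure Q)" by (rule Suc.IH)
  finally show ?case by (simp add: funpow_swap1)
qed

text \<open>Scaling by \<open>1 + r\<close> gives row \<open>i\<close> a slack of at least
  \<open>r * b $ i\<close>, while a unit of decrease costs it at most \<open>b $ i\<close> by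
  well-behavedness.\<close>

lemma covering_scaled_in_decrease_core:
  fixes A :: "real^'n^'m"
  assumes A: "\<And>i j. 0 \<le> A $ i $ j" and b: "\<And>i. 0 \<le> b $ i" and wb: "well_behaved A b"
    and x: "x \<in> covering_polyhedron A b" and r: "0 \<le> r"
  shows "(1 + r) *\<^sub>R x \<in> decrease_core r (covering_polyhedron A b)"
proof -
  have x0: "\<And>j. 0 \<le> x $ j" and Ax: "\<And>i. b $ i \<le> (A *v x) $ i"
    using x by (auto simp: covering_polyhedron_def)
  have "b $ i \<le> (A *v y) $ i" if y: "decrease ((1 + r) *\<^sub>R x) y \<le> r" for y i
  proof -
    let ?m = "\<lambda>j. max (((1 + r) *\<^sub>R x) $ j - y $ j) 0"
    have "(1 + r) * (A *v x) $ i - (A *v y) $ i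
        = (\<Sum>j\<in>UNIV. A $ i $ j * (((1 + r) *\<^sub>R x) $ j - y $ j))"
      by (simp add: matrix_vector_mult_def sum_distrib_left sum_subtractf algebra_simps sum.distrib)
    also have "\<dots> \<le> (\<Sum>j\<in>UNIV. b $ i * ?m j)"
    proof (rule sum_mono)
      fix j
      have "A $ i $ j * (((1 + r) *\<^sub>R x) $ j - y $ j) \<le> A $ i $ j * ?m j"
        by (intro mult_left_mono A) auto
      also have "\<dots> \<le> b $ i * ?m j"
        using wb by (intro mult_right_mono) (auto simp: well_behaved_def)
      finally show "A $ i $ j * (((1 + r) *\<^sub>R x) $ j - y $ j) \<le> b $ i * ?m j" .
    qed
    also have "\<dots> = b $ i * decrease ((1 + r) *\<^sub>R x) y"
      by (simp add: decrease_def sum_distrib_left)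
    also have "\<dots> \<le> b $ i * r" by (intro mult_left_mono y b)
    finally have "(1 + r) * (A *v x) $ i - (A *v y) $ i \<le> b $ i * r" .
    moreover have "(1 + r) * b $ i \<le> (1 + r) * (A *v x) $ i"
      using Ax r by (intro mult_left_mono) auto
    ultimately show ?thesis by (simp add: algebra_simps)
  qed
  then show ?thesis using x0 r by (auto simp: decrease_core_def covering_polyhedron_def)
qed

section \<open>Attainment of the two minima\<close>

lemma closed_covering_polyhedron: "closed (covering_polyhedron A b)"
  unfolding covering_polyhedron_def matrix_vector_mul_component
  by (intro closed_Collect_conj closed_Collect_all closed_Collect_le continuous_intros)

lemma convex_covering_polyhedron: "convex (covering_polyhedron A b)"
proof -
  have "covering_polyhedron A b = (\<Inter>j. {x. 0 \<le> axis j 1 \<bullet> x}) \<inter> (\<Inter>i. {x. b $ i \<le> A $ i \<bullet> x})"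
    by (auto simp: covering_polyhedron_def matrix_vector_mul_component inner_axis')
  then show ?thesis
    by (simp add: convex_Int convex_INT convex_halfspace_ge)
qed

lemma closed_int_vectors: "closed (int_vectors :: (real^'n) set)"
proof -
  have "closed ((\<lambda>x::real^'n. x $ j) -` \<int>)" for j
    by (intro closed_vimage closed_Ints continuous_intros)
  then have "closed (\<Inter>j. (\<lambda>x::real^'n. x $ j) -` \<int>)" by (intro closed_INT) auto
  moreover have "(\<Inter>j. (\<lambda>x::real^'n. x $ j) -` \<int>) = int_vectors"
    by (auto simp: int_vectors_def)
  ultimately show ?thesis by simp
qed

text \<open>Coordinates of zero cost may be unbounded on near-optimal points; pinning them to \<open>M\<close>
  makes the relevant part of \<open>X\<close> compact.\<close>

lemma nonneg_objective_attains_min: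
  fixes X :: "(real^'n) set"
  assumes c: "\<And>j. 0 \<le> c $ j" and X: "closed X" "X \<noteq> {}" and X0: "\<And>x j. x \<in> X \<Longrightarrow> 0 \<le> x $ j"
    and M: "\<And>x. x \<in> X \<Longrightarrow> (\<chi> j. if c $ j = 0 then M $ j else x $ j) \<in> X"
  obtains x where "x \<in> X" "\<And>y. y \<in> X \<Longrightarrow> c \<bullet> x \<le> c \<bullet> y"
proof -
  define p where "p x = (\<chi> j. if c $ j = 0 then M $ j else x $ j)" for x :: "real^'n"
  have pX: "p x \<in> X" if "x \<in> X" for x using M[OF that] by (simp add: p_def)
  have cp: "c \<bullet> p x = c \<bullet> x" for x
    by (auto simp: inner_vec_def p_def intro!: sum.cong)
  obtain x0 where x0: "x0 \<in> X" using X by auto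
  \<comment> \<open>Where the cost is positive,
    \<open>c $ j * x $ j \<le> c \<bullet> x \<le> c \<bullet> x0\<close> bounds the
    coordinate.\<close>
  define B where "B = (\<chi> j. if c $ j = 0 then M $ j else (c \<bullet> x0) / c $ j)"
  let ?K = "X \<inter> cbox 0 B"
  have pK: "p x \<in> ?K" if x: "x \<in> X" "c \<bullet> x \<le> c \<bullet> x0" for x
  proof -
    have "p x $ j \<le> B $ j" for j
    proof (cases "c $ j = 0")
      case False
      have "c $ j * x $ j \<le> c \<bullet> x"
        unfolding inner_vec_def using member_le_sum[of j UNIV "\<lambda>j. c $ j * x $ j"] c X0[OF x(1)]
        by simp
      with x False c[of j] show ?thesis
        by (simp add: p_def B_def field_simps)
    qed (simp add: p_def B_def)
    then show ?thesis using X0[OF pX[OF x(1)]] pX[OF x(1)] by (simp add: mem_box_cart)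
  qed
  have "compact ?K" "?K \<noteq> {}"
    using X pK[OF x0] by (auto simp: closed_Int_compact)
  then obtain x where x: "x \<in> ?K" "\<And>y. y \<in> ?K \<Longrightarrow> c \<bullet> x \<le> c \<bullet> y"
    using continuous_attains_inf[of ?K "\<lambda>x. c \<bullet> x"] continuous_on_inner[OF continuous_on_const continuous_on_id]
    by metis
  have "c \<bullet> x \<le> c \<bullet> y" if "y \<in> X" for y
    using x(2)[OF pK, of y] x(2)[OF pK, of x0] x0 that cp by (cases "c \<bullet> y \<le> c \<bullet> x0") auto
  then show thesis using that x by blast
qed

text \<open>Here \<open>b\<^sub>i / 0 = 0\<close> makes the rows with \<open>A\<^sub>i\<^sub>j = 0\<close> contribute nothing.\<close>

definition cap :: "real^'n^'m \<Rightarrow> real^'m \<Rightarrow> real^'n" where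
  "cap A b = (\<chi> j. of_int \<lceil>\<Sum>i\<in>UNIV. b $ i / A $ i $ j\<rceil>)"

text \<open>A row with a nonzero entry in a pinned column is covered by that column alone; every
  other row keeps its value.\<close>

lemma covering_polyhedron_cap:
  fixes A :: "real^'n^'m"
  assumes A: "\<And>i j. 0 \<le> A $ i $ j" and b: "\<And>i. 0 \<le> b $ i"
    and x: "x \<in> covering_polyhedron A b"
  shows "(\<chi> j. if c $ j = 0 then cap A b $ j else x $ j) \<in> covering_polyhedron A b"
    (is "?p \<in> _")
proof -
  have x0: "\<And>j. 0 \<le> x $ j" and Ax: "\<And>i. b $ i \<le> (A *v x) $ i"
    using x by (auto simp: covering_polyhedron_def)
  have cap: "b $ i / A $ i $ j \<le> cap A b $ j" for i j
  proof -
    have "b $ i / A $ i $ j \<le> (\<Sum>i\<in>UNIV. b $ i / A $ i $ j)"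
      by (rule member_le_sum) (use A b in auto)
    then show ?thesis unfolding cap_def by simp linarith
  qed
  have cap0: "0 \<le> cap A b $ j" for j
    using cap[of undefined j] A[of undefined j] b[of undefined] by (meson divide_nonneg_nonneg order_trans)
  have p0: "0 \<le> ?p $ j" for j using x0 cap0 by simp
  have "b $ i \<le> (A *v ?p) $ i" for i
  proof (cases "\<exists>j. c $ j = 0 \<and> A $ i $ j \<noteq> 0")
    case True
    then obtain j where j: "c $ j = 0" "A $ i $ j \<noteq> 0" by auto
    have Apos: "0 < A $ i $ j" using A[of i j] j by simp
    have "b $ i \<le> A $ i $ j * ?p $ j"
      using cap[of i j] j Apos by (simp add: field_simps)
    also have "\<dots> \<le> (\<Sum>j\<in>UNIV. A $ i $ j * ?p $ j)"
      by (rule member_le_sum) (use A p0 in \<open>auto intro!: mult_nonneg_nonneg\<close>)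
    finally show ?thesis by (simp add: matrix_vector_mult_def)
  next
    case False
    then have "(A *v ?p) $ i = (A *v x) $ i"
      by (auto simp: matrix_vector_mult_def intro!: sum.cong)
    then show ?thesis using Ax by simp
  qed
  then show ?thesis using p0 by (simp add: covering_polyhedron_def)
qed

lemma min_value_eqI:
  assumes "x \<in> P" "\<And>y. y \<in> P \<Longrightarrow> c \<bullet> x \<le> c \<bullet> y"
  shows "min_value P c = c \<bullet> x"
  unfolding min_value_def by (rule Least_equality) (use assms in auto)

lemma z_LP_attained:
  fixes A :: "real^'n^'m"
  assumes A: "\<And>i j. 0 \<le> A $ i $ j" and b: "\<And>i. 0 \<le> b $ i" and c: "\<And>j. 0 \<le> c $ j"
    and ne: "covering_polyhedron A b \<noteq> {}"
  obtains x where "x \<in> covering_polyhedron A b" "z_LP A b c = c \<bullet> x"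
    "\<And>y. y \<in> covering_polyhedron A b \<Longrightarrow> c \<bullet> x \<le> c \<bullet> y"
proof -
  have "\<And>x j. x \<in> covering_polyhedron A b \<Longrightarrow> 0 \<le> x $ j"
    by (simp add: covering_polyhedron_def)
  from nonneg_objective_attains_min[OF c closed_covering_polyhedron ne this
      covering_polyhedron_cap[OF A b]]
  obtain x where "x \<in> covering_polyhedron A b"
    "\<And>y. y \<in> covering_polyhedron A b \<Longrightarrow> c \<bullet> x \<le> c \<bullet> y"
    by metis
  then show thesis using that min_value_eqI[of x _ c] unfolding z_LP_def by metis
qed

text \<open>The minimum is found over the closed set of integer points. It carries over to their
  hull because a half-space is convex.\<close>

lemma z_I_attained:
  fixes A :: "real^'n^'m"
  assumes A: "\<And>i j. 0 \<le> A $ i $ j" and b: "\<And>i. 0 \<le> b $ i" and c: "\<And>j. 0 \<le> c $ j"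
    and ne: "integer_hull (covering_polyhedron A b) \<noteq> {}"
  obtains x where "x \<in> integer_hull (covering_polyhedron A b)" "z_I A b c = c \<bullet> x"
    "\<And>y. y \<in> integer_hull (covering_polyhedron A b) \<Longrightarrow> c \<bullet> x \<le> c \<bullet> y"
proof -
  let ?X = "covering_polyhedron A b \<inter> int_vectors"
  have X1: "closed ?X" by (simp add: closed_Int closed_covering_polyhedron closed_int_vectors)
  have X2: "?X \<noteq> {}" using ne by (auto simp: integer_hull_def)
  have X3: "\<And>x j. x \<in> ?X \<Longrightarrow> 0 \<le> x $ j" by (simp add: covering_polyhedron_def)
  \<comment> \<open>The ceiling in \<open>cap\<close> keeps pinned points integral.\<close>
  have X4: "\<And>x. x \<in> ?X \<Longrightarrow> (\<chi> j. if c $ j = 0 then cap A b $ j else x $ j) \<in> ?X"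
    using covering_polyhedron_cap[OF A b] by (auto simp: int_vectors_def cap_def)
  obtain x where x: "x \<in> ?X" "\<And>y. y \<in> ?X \<Longrightarrow> c \<bullet> x \<le> c \<bullet> y"
    by (rule nonneg_objective_attains_min[OF c X1 X2 X3 X4]) (assumption+, rule that, simp_all)
  have "integer_hull (covering_polyhedron A b) \<subseteq> {y. c \<bullet> x \<le> c \<bullet> y}"
    unfolding integer_hull_def
    by (rule hull_minimal) (use x in \<open>auto simp: convex_halfspace_ge\<close>)
  moreover have "x \<in> integer_hull (covering_polyhedron A b)"
    unfolding integer_hull_def by (rule hull_inc) (rule x)
  ultimately show thesis using that min_value_eqI[of x _ c] unfolding z_I_def by blast
qed

section \<open>From the rank to the integrality gap\<close>

lemma integrality_gap_le:
  fixes A :: "real^'n^'m"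
  assumes A: "\<And>i j. 0 \<le> A $ i $ j" and b: "\<And>i. 0 \<le> b $ i" and wb: "well_behaved A b"
    and k: "(split_closure ^^ k) (covering_polyhedron A b) = integer_hull (covering_polyhedron A b)"
    and c: "c \<in> admissible_objectives A b"
  shows "0 < z_LP A b c" "z_LP A b c \<le> z_I A b c" "z_I A b c \<le> (1 + real k) * z_LP A b c"
proof -
  have c0: "\<And>j. 0 \<le> c $ j" and ne: "covering_polyhedron A b \<noteq> {}" and nz: "z_LP A b c \<noteq> 0"
    using c by (auto simp: admissible_objectives_def)
  obtain x where x: "x \<in> covering_polyhedron A b" "z_LP A b c = c \<bullet> x"
    "\<And>y. y \<in> covering_polyhedron A b \<Longrightarrow> c \<bullet> x \<le> c \<bullet> y"
    using z_LP_attained[OF A b c0 ne] by metis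
  have "0 \<le> c \<bullet> x"
    using x(1) c0 by (auto simp: inner_vec_def covering_polyhedron_def intro!: sum_nonneg)
  then show "0 < z_LP A b c" using nz x(2) by simp
  \<comment> \<open>Besides bounding \<open>z_I\<close>, this point shows that the integer hull is
    nonempty, so that its minimum is attained.\<close>
  have xI: "(1 + real k) *\<^sub>R x \<in> integer_hull (covering_polyhedron A b)"
    using covering_scaled_in_decrease_core[OF A b wb x(1), of "real k"] decrease_core_funpow k
    by fastforce
  then obtain y where y: "y \<in> integer_hull (covering_polyhedron A b)" "z_I A b c = c \<bullet> y"
    "\<And>y'. y' \<in> integer_hull (covering_polyhedron A b) \<Longrightarrow> c \<bullet> y \<le> c \<bullet> y'"
    using z_I_attained[OF A b c0] by (metis empty_iff)
  have "integer_hull (covering_polyhedron A b) \<subseteq> covering_polyhedron A b"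
    unfolding integer_hull_def by (rule hull_minimal) (auto simp: convex_covering_polyhedron)
  \<comment> \<open>This keeps the quotient positive, as its logarithm requires.\<close>
  then show "z_LP A b c \<le> z_I A b c" using x y by auto
  show "z_I A b c \<le> (1 + real k) * z_LP A b c" using y(3)[OF xI] x(2) y(2) by simp
qed

text \<open>An infimum in \<open>enat\<close> is infinite on the empty set and otherwise attained,
  by well-ordering.\<close>

lemma split_rank_eq_enatD:
  assumes "split_rank P = enat k"
  shows "(split_closure ^^ k) P = integer_hull P"
proof -
  let ?S = "enat ` {k. (split_closure ^^ k) P = integer_hull P}"
  have "Inf ?S \<noteq> \<infinity>" using assms by (simp add: split_rank_def)
  then have "?S \<noteq> {}" unfolding Inf_enat_def by presburger
  then have "Inf ?S \<in> ?S" unfolding Inf_enat_def using LeastI_ex[of "\<lambda>x. x \<in> ?S"] by auto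
  then have "enat k \<in> ?S" using assms by (simp add: split_rank_def)
  then show ?thesis by auto
qed

theorem corollary2:
  fixes A :: "real^'n^'m" and b :: "real^'m"
  assumes "\<forall>i j. A $ i $ j \<in> \<rat> \<and> 0 \<le> A $ i $ j"
    and "\<forall>i. b $ i \<in> \<rat> \<and> 0 \<le> b $ i"
    and "well_behaved A b"
  shows "ereal_of_enat (split_rank (covering_polyhedron A b))
    \<ge> (SUP c\<in>admissible_objectives A b.
          ereal (real_of_int \<lceil>log 2 (z_I A b c / z_LP A b c)\<rceil>))"
proof (cases "split_rank (covering_polyhedron A b)")
  case (enat k)
  have "\<lceil>log 2 (z_I A b c / z_LP A b c)\<rceil> \<le> int k" if c: "c \<in> admissible_objectives A b" for c
  proof -
    have pos: "0 < z_LP A b c" and ge: "z_LP A b c \<le> z_I A b c"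
      and le: "z_I A b c \<le> (1 + real k) * z_LP A b c"
      using integrality_gap_le[OF _ _ assms(3) split_rank_eq_enatD[OF enat] c] assms by auto
    have "z_I A b c / z_LP A b c \<le> 1 + real k" using pos le by (simp add: field_simps)
    also have "\<dots> \<le> 2 powr real k"
      using Bernoulli_inequality[of 1 k] by (simp add: powr_realpow)
    finally have "log 2 (z_I A b c / z_LP A b c) \<le> real k"
      using pos ge by (simp add: log_le_iff)
    then show ?thesis by (simp add: ceiling_le_iff)
  qed
  \<comment> \<open>\<open>SUP_least\<close> also covers an empty set of objectives, whose supremum
    is \<open>-\<infinity>\<close>.\<close>
  then show ?thesis unfolding enat by (auto intro!: SUP_least) (metis of_int_le_iff of_int_of_nat_eq)
qed simp

end
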